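(* Every residuated lattice with the Boolean Lifting Property (BLP) is a Gelfand residuated lattice; that is, residuated lattices with BLP form a subclass of the class of Gelfand residuated lattices.
   Context: A residuated lattice is an algebra $(A,\vee,\wedge,\odot,\rightarrow,0,1)$ such that $(A,\vee,\wedge,0,1)$ is a bounded lattice (with order $\leq$), $(A,\odot,1)$ is a commutative monoid, and $a\leq b\rightarrow c$ iff $a\odot b\leq c$ for all $a,b,c$. Put $a\leftrightarrow b=(a\rightarrow b)\wedge(b\rightarrow a)$. $\mathcal{B}(A)$ is the set of complemented elements of the bounded lattice $(A,\vee,\wedge,0,1)$. A filter of $A$ is a non-empty subset closed under $\odot$ and upward closed; it is proper if it is not $A$. For a filter $F$, $x\equiv y\ (\mathrm{mod}\ F)$ iff $x\leftrightarrow y\in F$ is a congruence; $A/F$ is the quotient residuated lattice, $x/F$ the class of $x$, $\mathcal{B}(A)/F=\{e/F\mid e\in\mathcal{B}(A)\}$. A filter $F$ has BLP iff $\mathcal{B}(A/F)=\mathcal{B}(A)/F$; $A$ has BLP iff every filter of $A$ has BLP. A prime filter is a proper filter $P$ such that $a\vee b\in P$ implies $a\in P$ or $b\in P$; a maximal filter is a maximal proper filter. $A$ is Gelfand iff every prime filter of $A$ is included in a unique maximal filter of $A$. *)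

theory Defs
  imports "HOL-Algebra.Group"
begin

text \<open>
  The algebras are carrier based, extending the commutative monoids of HOL-Algebra, because an
  algebra and its quotients (whose elements are classes) have to be compared.
\<close>

record 'a rlat = "'a monoid" +
  rjoin :: "'a \<Rightarrow> 'a \<Rightarrow> 'a" (infixl "\<curlyvee>\<index>" 65)
  rmeet :: "'a \<Rightarrow> 'a \<Rightarrow> 'a" (infixl "\<curlywedge>\<index>" 67)
  rimp :: "'a \<Rightarrow> 'a \<Rightarrow> 'a" (infixr "\<leadsto>\<index>" 62)
  rzero :: 'a ("\<zero>\<index>")

definition rle :: "('a, 'm) rlat_scheme \<Rightarrow> 'a \<Rightarrow> 'a \<Rightarrow> bool" (infix "\<preceq>\<index>" 50)
  where "a \<preceq>\<^bsub>L\<^esub> b \<longleftrightarrow> a \<curlywedge>\<^bsub>L\<^esub> b = a"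

text \<open>
  The unit of the monoid is at the same time the greatest element of the lattice.
\<close>

locale residuated_lattice = comm_monoid L for L (structure) +
  assumes join_closed: "\<lbrakk>a \<in> carrier L; b \<in> carrier L\<rbrakk> \<Longrightarrow> a \<curlyvee> b \<in> carrier L"
    and meet_closed: "\<lbrakk>a \<in> carrier L; b \<in> carrier L\<rbrakk> \<Longrightarrow> a \<curlywedge> b \<in> carrier L"
    and imp_closed: "\<lbrakk>a \<in> carrier L; b \<in> carrier L\<rbrakk> \<Longrightarrow> a \<leadsto> b \<in> carrier L"
    and zero_closed: "\<zero> \<in> carrier L"
    and join_assoc: "\<lbrakk>a \<in> carrier L; b \<in> carrier L; c \<in> carrier L\<rbrakk>
          \<Longrightarrow> (a \<curlyvee> b) \<curlyvee> c = a \<curlyvee> (b \<curlyvee> c)"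
    and meet_assoc: "\<lbrakk>a \<in> carrier L; b \<in> carrier L; c \<in> carrier L\<rbrakk>
          \<Longrightarrow> (a \<curlywedge> b) \<curlywedge> c = a \<curlywedge> (b \<curlywedge> c)"
    and join_comm: "\<lbrakk>a \<in> carrier L; b \<in> carrier L\<rbrakk> \<Longrightarrow> a \<curlyvee> b = b \<curlyvee> a"
    and meet_comm: "\<lbrakk>a \<in> carrier L; b \<in> carrier L\<rbrakk> \<Longrightarrow> a \<curlywedge> b = b \<curlywedge> a"
    and join_absorb: "\<lbrakk>a \<in> carrier L; b \<in> carrier L\<rbrakk> \<Longrightarrow> a \<curlyvee> (a \<curlywedge> b) = a"
    and meet_absorb: "\<lbrakk>a \<in> carrier L; b \<in> carrier L\<rbrakk> \<Longrightarrow> a \<curlywedge> (a \<curlyvee> b) = a"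
    and zero_least: "a \<in> carrier L \<Longrightarrow> \<zero> \<preceq> a"
    and one_greatest: "a \<in> carrier L \<Longrightarrow> a \<preceq> \<one>"
    and residuation: "\<lbrakk>a \<in> carrier L; b \<in> carrier L; c \<in> carrier L\<rbrakk>
          \<Longrightarrow> a \<preceq> b \<leadsto> c \<longleftrightarrow> a \<otimes> b \<preceq> c"

definition riff :: "('a, 'm) rlat_scheme \<Rightarrow> 'a \<Rightarrow> 'a \<Rightarrow> 'a"
  where "riff L a b = (a \<leadsto>\<^bsub>L\<^esub> b) \<curlywedge>\<^bsub>L\<^esub> (b \<leadsto>\<^bsub>L\<^esub> a)"

definition boolean_center :: "('a, 'm) rlat_scheme \<Rightarrow> 'a set"
  where "boolean_center L =
    {e \<in> carrier L. \<exists>f \<in> carrier L. e \<curlyvee>\<^bsub>L\<^esub> f = \<one>\<^bsub>L\<^esub> \<and> e \<curlywedge>\<^bsub>L\<^esub> f = \<zero>\<^bsub>L\<^esub>}"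

definition rfilter :: "('a, 'm) rlat_scheme \<Rightarrow> 'a set \<Rightarrow> bool"
  where "rfilter L F \<longleftrightarrow>
    F \<subseteq> carrier L \<and> F \<noteq> {} \<and>
    (\<forall>a \<in> F. \<forall>b \<in> F. a \<otimes>\<^bsub>L\<^esub> b \<in> F) \<and>
    (\<forall>a \<in> F. \<forall>b \<in> carrier L. a \<preceq>\<^bsub>L\<^esub> b \<longrightarrow> b \<in> F)"

definition proper_rfilter :: "('a, 'm) rlat_scheme \<Rightarrow> 'a set \<Rightarrow> bool"
  where "proper_rfilter L F \<longleftrightarrow> rfilter L F \<and> F \<noteq> carrier L"

definition prime_rfilter :: "('a, 'm) rlat_scheme \<Rightarrow> 'a set \<Rightarrow> bool"
  where "prime_rfilter L P \<longleftrightarrow> proper_rfilter L P \<and>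
    (\<forall>a \<in> carrier L. \<forall>b \<in> carrier L. a \<curlyvee>\<^bsub>L\<^esub> b \<in> P \<longrightarrow> a \<in> P \<or> b \<in> P)"

definition maximal_rfilter :: "('a, 'm) rlat_scheme \<Rightarrow> 'a set \<Rightarrow> bool"
  where "maximal_rfilter L M \<longleftrightarrow> proper_rfilter L M \<and>
    (\<forall>F. proper_rfilter L F \<and> M \<subseteq> F \<longrightarrow> F = M)"

definition rcong :: "('a, 'm) rlat_scheme \<Rightarrow> 'a set \<Rightarrow> ('a \<times> 'a) set"
  where "rcong L F = {(x, y). x \<in> carrier L \<and> y \<in> carrier L \<and> riff L x y \<in> F}"

definition rclass :: "('a, 'm) rlat_scheme \<Rightarrow> 'a set \<Rightarrow> 'a \<Rightarrow> 'a set"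
  where "rclass L F x = rcong L F `` {x}"

text \<open>
  Operations on classes are computed on representatives. The union runs over all choices of
  representatives; when \<^term>\<open>F\<close> is a filter, all of them give the same class
  (compare \<open>UN_equiv_class2\<close>).
\<close>

definition rlift2 ::
    "('a, 'm) rlat_scheme \<Rightarrow> 'a set \<Rightarrow> ('a \<Rightarrow> 'a \<Rightarrow> 'a) \<Rightarrow> 'a set \<Rightarrow> 'a set \<Rightarrow> 'a set"
  where "rlift2 L F g X Y = (\<Union>x \<in> X. \<Union>y \<in> Y. rclass L F (g x y))"

definition rquot :: "('a, 'm) rlat_scheme \<Rightarrow> 'a set \<Rightarrow> 'a set rlat"
  where "rquot L F =
    \<lparr>carrier = carrier L // rcong L F,
     mult = rlift2 L F (mult L),
     one = rclass L F \<one>\<^bsub>L\<^esub>,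
     rjoin = rlift2 L F (rjoin L),
     rmeet = rlift2 L F (rmeet L),
     rimp = rlift2 L F (rimp L),
     rzero = rclass L F \<zero>\<^bsub>L\<^esub>\<rparr>"

definition filter_BLP :: "('a, 'm) rlat_scheme \<Rightarrow> 'a set \<Rightarrow> bool"
  where "filter_BLP L F \<longleftrightarrow> boolean_center (rquot L F) = rclass L F ` boolean_center L"

definition BLP :: "('a, 'm) rlat_scheme \<Rightarrow> bool"
  where "BLP L \<longleftrightarrow> (\<forall>F. rfilter L F \<longrightarrow> filter_BLP L F)"

definition Gelfand :: "('a, 'm) rlat_scheme \<Rightarrow> bool"
  where "Gelfand L \<longleftrightarrow>
    (\<forall>P. prime_rfilter L P \<longrightarrow> (\<exists>!M. maximal_rfilter L M \<and> P \<subseteq> M))"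

end

theory Submission
  imports Defs
begin

text \<open>
  Zorn's lemma puts every proper filter inside a maximal one, so only uniqueness is at stake.

  Suppose that a prime filter \<open>P\<close> lies in two different maximal filters \<open>M\<close> and \<open>N\<close>. By
  maximality the filter generated by \<open>M \<union> N\<close> is everything, so there are \<open>m \<in> M\<close> and \<open>n \<in> N\<close>
  with \<open>m \<otimes> n = \<zero>\<close> (\<open>distinct_maximal_disjoint_elements\<close>). Modulo the filter \<open>M \<inter> N\<close> the
  elements \<open>m\<close> and \<open>n\<close> are complements of each other: \<open>m \<curlyvee> n\<close> lies in both \<open>M\<close> and \<open>N\<close>, and
  the negation of \<open>m \<curlywedge> n\<close> lies above \<open>m\<close> as well as above \<open>n\<close>
  (\<open>class_complemented_mod_Int\<close>). BLP for \<open>M \<inter> N\<close> replaces \<open>m\<close> by a congruent element \<open>e\<close> that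
  has a complement \<open>f\<close> in the algebra itself. Since \<open>m\<close> lies in \<open>M\<close> but, by \<open>m \<otimes> n = \<zero>\<close>, not
  in \<open>N\<close>, the same is true of \<open>e\<close>; then \<open>f \<notin> M\<close>, because \<open>e \<curlywedge> f = \<zero>\<close>. But \<open>e \<curlyvee> f = \<one>\<close>
  belongs to \<open>P\<close>, so primeness puts \<open>e\<close> or \<open>f\<close> into \<open>P \<subseteq> M \<inter> N\<close>, a contradiction.
\<close>

section \<open>Order and residuation\<close>

context residuated_lattice
begin

lemma le_refl: "a \<in> carrier L \<Longrightarrow> a \<preceq> a"
  unfolding rle_def by (metis join_absorb meet_absorb meet_closed)

lemma le_antisym: "\<lbrakk>a \<in> carrier L; b \<in> carrier L; a \<preceq> b; b \<preceq> a\<rbrakk> \<Longrightarrow> a = b"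
  unfolding rle_def by (metis meet_comm)

lemma le_trans:
  "\<lbrakk>a \<in> carrier L; b \<in> carrier L; c \<in> carrier L; a \<preceq> b; b \<preceq> c\<rbrakk> \<Longrightarrow> a \<preceq> c"
  unfolding rle_def by (metis meet_assoc)

lemma meet_le2: "\<lbrakk>a \<in> carrier L; b \<in> carrier L\<rbrakk> \<Longrightarrow> a \<curlywedge> b \<preceq> b"
  using le_refl[of b] unfolding rle_def by (simp add: meet_assoc)

lemma meet_le1: "\<lbrakk>a \<in> carrier L; b \<in> carrier L\<rbrakk> \<Longrightarrow> a \<curlywedge> b \<preceq> a"
  using meet_le2[of b a] by (simp add: meet_comm)

lemma le_meet:
  "\<lbrakk>a \<in> carrier L; b \<in> carrier L; c \<in> carrier L; c \<preceq> a; c \<preceq> b\<rbrakk> \<Longrightarrow> c \<preceq> a \<curlywedge> b"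
  unfolding rle_def by (metis meet_assoc)

lemma le_join1: "\<lbrakk>a \<in> carrier L; b \<in> carrier L\<rbrakk> \<Longrightarrow> a \<preceq> a \<curlyvee> b"
  unfolding rle_def by (rule meet_absorb)

lemma le_join2: "\<lbrakk>a \<in> carrier L; b \<in> carrier L\<rbrakk> \<Longrightarrow> b \<preceq> a \<curlyvee> b"
  using le_join1[of b a] by (simp add: join_comm)

lemma mult_right_mono:
  assumes "a \<in> carrier L" "b \<in> carrier L" "c \<in> carrier L" "a \<preceq> b"
  shows "a \<otimes> c \<preceq> b \<otimes> c"
proof -
  have "b \<preceq> c \<leadsto> b \<otimes> c"
    using assms by (simp add: residuation le_refl)
  then have "a \<preceq> c \<leadsto> b \<otimes> c"
    using assms le_trans[of a b "c \<leadsto> b \<otimes> c"] by (simp add: imp_closed)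
  then show ?thesis
    using assms by (simp add: residuation)
qed

lemma mult_mono:
  assumes "a \<in> carrier L" "b \<in> carrier L" "c \<in> carrier L" "d \<in> carrier L" "a \<preceq> b" "c \<preceq> d"
  shows "a \<otimes> c \<preceq> b \<otimes> d"
proof -
  have "a \<otimes> c \<preceq> b \<otimes> c" "b \<otimes> c \<preceq> b \<otimes> d"
    using assms mult_right_mono[of a b c] mult_right_mono[of c d b] by (simp_all add: m_comm)
  then show ?thesis
    using assms le_trans[of "a \<otimes> c" "b \<otimes> c" "b \<otimes> d"] by simp
qed

text \<open>
  A product lies below its factors because the unit is the greatest element. This is why filters,
  defined by closure under products, are also closed under meets.
\<close>

lemma mult_le1: "\<lbrakk>a \<in> carrier L; b \<in> carrier L\<rbrakk> \<Longrightarrow> a \<otimes> b \<preceq> a"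
  using mult_mono[of a a b \<one>] le_refl[of a] one_greatest[of b] by simp

lemma mult_le2: "\<lbrakk>a \<in> carrier L; b \<in> carrier L\<rbrakk> \<Longrightarrow> a \<otimes> b \<preceq> b"
  using mult_le1[of b a] by (simp add: m_comm)

lemma imp_mult_le: "\<lbrakk>a \<in> carrier L; b \<in> carrier L\<rbrakk> \<Longrightarrow> (a \<leadsto> b) \<otimes> a \<preceq> b"
  using residuation[of "a \<leadsto> b" a b] le_refl[of "a \<leadsto> b"] imp_closed[of a b] by simp

lemma le_imp: "\<lbrakk>a \<in> carrier L; b \<in> carrier L\<rbrakk> \<Longrightarrow> a \<preceq> b \<leadsto> a"
  using residuation[of a b a] mult_le1[of a b] by simp

lemma imp_eq_one: "\<lbrakk>a \<in> carrier L; b \<in> carrier L; a \<preceq> b\<rbrakk> \<Longrightarrow> a \<leadsto> b = \<one>"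
  using residuation[of \<one> a b] le_antisym[of "a \<leadsto> b" \<one>] one_greatest[of "a \<leadsto> b"]
  by (simp add: imp_closed)

lemma imp_trans_le:
  assumes "a \<in> carrier L" "b \<in> carrier L" "c \<in> carrier L"
  shows "(a \<leadsto> b) \<otimes> (b \<leadsto> c) \<preceq> a \<leadsto> c"
proof -
  note closed = imp_closed[OF assms(1,2)] imp_closed[OF assms(2,3)]
  have "(b \<leadsto> c) \<otimes> ((a \<leadsto> b) \<otimes> a) \<preceq> (b \<leadsto> c) \<otimes> b"
    using assms closed mult_mono imp_mult_le le_refl by simp
  then have "(b \<leadsto> c) \<otimes> ((a \<leadsto> b) \<otimes> a) \<preceq> c"
    using assms closed imp_mult_le[of b c] le_trans[of _ "(b \<leadsto> c) \<otimes> b" c] by simp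
  then have "((a \<leadsto> b) \<otimes> (b \<leadsto> c)) \<otimes> a \<preceq> c"
    using assms closed by (metis m_assoc m_comm)
  then show ?thesis
    using assms closed residuation by simp
qed

section \<open>Filters and their congruences\<close>

lemma rfilterI:
  assumes "F \<subseteq> carrier L" "\<one> \<in> F"
    and "\<And>a b. \<lbrakk>a \<in> F; b \<in> F\<rbrakk> \<Longrightarrow> a \<otimes> b \<in> F"
    and "\<And>a b. \<lbrakk>a \<in> F; b \<in> carrier L; a \<preceq> b\<rbrakk> \<Longrightarrow> b \<in> F"
  shows "rfilter L F"
  using assms unfolding rfilter_def by blast

lemma filter_closed: "\<lbrakk>rfilter L F; a \<in> F\<rbrakk> \<Longrightarrow> a \<in> carrier L"
  unfolding rfilter_def by blast

lemma filter_up: "\<lbrakk>rfilter L F; a \<in> F; b \<in> carrier L; a \<preceq> b\<rbrakk> \<Longrightarrow> b \<in> F"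
  unfolding rfilter_def by blast

lemma filter_mult: "\<lbrakk>rfilter L F; a \<in> F; b \<in> F\<rbrakk> \<Longrightarrow> a \<otimes> b \<in> F"
  unfolding rfilter_def by blast

lemma filter_one: "rfilter L F \<Longrightarrow> \<one> \<in> F"
  unfolding rfilter_def using one_greatest by blast

lemma filter_meet_iff:
  assumes F: "rfilter L F" and "a \<in> carrier L" "b \<in> carrier L"
  shows "a \<curlywedge> b \<in> F \<longleftrightarrow> a \<in> F \<and> b \<in> F"
proof
  assume "a \<curlywedge> b \<in> F"
  then show "a \<in> F \<and> b \<in> F"
    using assms meet_le1 meet_le2 filter_up[OF F] by blast
next
  assume "a \<in> F \<and> b \<in> F"
  then have "a \<otimes> b \<in> F"
    using filter_mult[OF F] by blast
  moreover have "a \<otimes> b \<preceq> a \<curlywedge> b"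
    using assms le_meet mult_le1 mult_le2 by simp
  ultimately show "a \<curlywedge> b \<in> F"
    using assms filter_up[OF F] meet_closed by blast
qed

lemma filter_mp:
  assumes F: "rfilter L F" and "a \<in> F" "a \<leadsto> b \<in> F" "b \<in> carrier L"
  shows "b \<in> F"
proof (rule filter_up[OF F])
  show "(a \<leadsto> b) \<otimes> a \<in> F" "(a \<leadsto> b) \<otimes> a \<preceq> b" "b \<in> carrier L"
    using assms filter_mult[OF F] imp_mult_le filter_closed[OF F] by simp_all
qed

lemma filter_imp_trans:
  assumes F: "rfilter L F" and "a \<leadsto> b \<in> F" "b \<leadsto> c \<in> F"
    and "a \<in> carrier L" "b \<in> carrier L" "c \<in> carrier L"
  shows "a \<leadsto> c \<in> F"
proof (rule filter_up[OF F])
  show "(a \<leadsto> b) \<otimes> (b \<leadsto> c) \<in> F" "(a \<leadsto> b) \<otimes> (b \<leadsto> c) \<preceq> a \<leadsto> c"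
    "a \<leadsto> c \<in> carrier L"
    using assms filter_mult[OF F] imp_trans_le imp_closed by simp_all
qed

lemma proper_filter_iff: "proper_rfilter L F \<longleftrightarrow> rfilter L F \<and> \<zero> \<notin> F"
  unfolding proper_rfilter_def rfilter_def using zero_closed zero_least by blast

lemma filter_Int:
  assumes "rfilter L F" "rfilter L G"
  shows "rfilter L (F \<inter> G)"
proof (rule rfilterI)
  show "F \<inter> G \<subseteq> carrier L"
    using filter_closed[OF assms(1)] by blast
  show "\<one> \<in> F \<inter> G"
    using assms filter_one by simp
  show "a \<otimes> b \<in> F \<inter> G" if "a \<in> F \<inter> G" "b \<in> F \<inter> G" for a b
    using that assms filter_mult by simp
  show "b \<in> F \<inter> G" if "a \<in> F \<inter> G" "b \<in> carrier L" "a \<preceq> b" for a b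
    using that filter_up[OF assms(1)] filter_up[OF assms(2)] by blast
qed

lemma rcong_iff:
  assumes "rfilter L F"
  shows "(x, y) \<in> rcong L F \<longleftrightarrow>
    x \<in> carrier L \<and> y \<in> carrier L \<and> x \<leadsto> y \<in> F \<and> y \<leadsto> x \<in> F"
  unfolding rcong_def riff_def using filter_meet_iff[OF assms] imp_closed by auto

lemma equiv_rcong:
  assumes F: "rfilter L F"
  shows "equiv (carrier L) (rcong L F)"
proof (rule equivI)
  show "rcong L F \<subseteq> carrier L \<times> carrier L"
    unfolding rcong_def by blast
  show "refl_on (carrier L) (rcong L F)"
    by (rule refl_onI) (simp add: rcong_iff[OF F] imp_eq_one le_refl filter_one[OF F])
  show "sym (rcong L F)"
    by (rule symI) (simp add: rcong_iff[OF F])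
  show "trans (rcong L F)"
    by (rule transI) (use filter_imp_trans[OF F] in \<open>auto simp: rcong_iff[OF F]\<close>)
qed

text \<open>
  A lifted operation is a union over all choices of representatives, so it can be evaluated on two
  given classes as soon as all these choices lead to the same class.
\<close>

lemma rlift2_eqI:
  assumes "x \<in> X" "y \<in> Y"
    and const: "\<And>x y. \<lbrakk>x \<in> X; y \<in> Y\<rbrakk> \<Longrightarrow> rclass L F (g x y) = C"
  shows "rlift2 L F g X Y = C"
proof -
  have "rlift2 L F g X Y = (\<Union>x\<in>X. \<Union>y\<in>Y. C)"
    unfolding rlift2_def by (intro SUP_cong refl const)
  also have "\<dots> = C"
    using assms(1,2) by blast
  finally show ?thesis .
qed

lemma rclass_eq_one:
  assumes F: "rfilter L F" and a: "a \<in> F"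
  shows "rclass L F a = rclass L F \<one>"
proof -
  have "a \<in> carrier L"
    using filter_closed[OF F a] .
  then have "a \<leadsto> \<one> \<in> F" "\<one> \<leadsto> a \<in> F"
    using filter_up[OF F filter_one[OF F], of "a \<leadsto> \<one>"] filter_up[OF F a, of "\<one> \<leadsto> a"]
    by (simp_all add: le_imp imp_closed)
  then have "(a, \<one>) \<in> rcong L F"
    using rcong_iff[OF F] \<open>a \<in> carrier L\<close> by simp
  then show ?thesis
    unfolding rclass_def by (rule equiv_class_eq[OF equiv_rcong[OF F]])
qed

lemma rclass_eq_zero:
  assumes F: "rfilter L F" and a: "a \<in> carrier L" and neg: "a \<leadsto> \<zero> \<in> F"
  shows "rclass L F a = rclass L F \<zero>"
proof -
  have "\<zero> \<leadsto> a = \<one>"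
    using a by (simp add: imp_eq_one zero_closed zero_least)
  then have "\<zero> \<leadsto> a \<in> F"
    using filter_one[OF F] by simp
  then have "(a, \<zero>) \<in> rcong L F"
    using rcong_iff[OF F] a neg zero_closed by simp
  then show ?thesis
    unfolding rclass_def by (rule equiv_class_eq[OF equiv_rcong[OF F]])
qed

section \<open>Maximal filters\<close>

lemma maximal_filterD: "maximal_rfilter L M \<Longrightarrow> rfilter L M \<and> \<zero> \<notin> M"
  unfolding maximal_rfilter_def proper_filter_iff by (rule conjunct1)

lemma maximal_filter_eq:
  "\<lbrakk>maximal_rfilter L M; proper_rfilter L F; M \<subseteq> F\<rbrakk> \<Longrightarrow> F = M"
  unfolding maximal_rfilter_def by blast

text \<open>
  Being proper means omitting the single element \<open>\<zero>\<close>, so it survives unions. In the union of a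
  chain any two elements already lie in a common member, which makes the union closed under
  products.
\<close>

lemma proper_filter_subset_maximal:
  assumes P: "proper_rfilter L P"
  shows "\<exists>M. maximal_rfilter L M \<and> P \<subseteq> M"
proof -
  define A where "A = {F. proper_rfilter L F \<and> P \<subseteq> F}"
  have "\<exists>M\<in>A. \<forall>X\<in>A. M \<subseteq> X \<longrightarrow> X = M"
  proof (rule subset_Zorn_nonempty)
    show "A \<noteq> {}"
      using P unfolding A_def by blast
  next
    fix C
    assume "C \<noteq> {}" and chain: "subset.chain A C"
    have filt: "rfilter L F" "\<zero> \<notin> F" "P \<subseteq> F" if "F \<in> C" for F
      using that chain unfolding subset_chain_def A_def by (auto simp: proper_filter_iff)
    have "rfilter L (\<Union>C)"
    proof (rule rfilterI)
      show "\<Union>C \<subseteq> carrier L"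
        using filter_closed[OF filt(1)] by blast
      show "\<one> \<in> \<Union>C"
        using \<open>C \<noteq> {}\<close> filter_one[OF filt(1)] by blast
      show "a \<otimes> b \<in> \<Union>C" if ab: "a \<in> \<Union>C" "b \<in> \<Union>C" for a b
      proof -
        obtain F G where FG: "F \<in> C" "a \<in> F" "G \<in> C" "b \<in> G"
          using ab by blast
        then have "F \<subseteq> G \<or> G \<subseteq> F"
          using chain unfolding subset_chain_def by blast
        then show ?thesis
        proof
          assume "F \<subseteq> G"
          then have "a \<otimes> b \<in> G"
            using FG filter_mult[OF filt(1)[OF FG(3)]] by blast
          then show ?thesis
            using FG(3) by blast
        next
          assume "G \<subseteq> F"
          then have "a \<otimes> b \<in> F"
            using FG filter_mult[OF filt(1)[OF FG(1)]] by blast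
          then show ?thesis
            using FG(1) by blast
        qed
      qed
      show "b \<in> \<Union>C" if a: "a \<in> \<Union>C" and b: "b \<in> carrier L" "a \<preceq> b" for a b
      proof -
        obtain F where F: "F \<in> C" "a \<in> F"
          using a by blast
        then show ?thesis
          using filter_up[OF filt(1)[OF F(1)] F(2) b] by blast
      qed
    qed
    moreover have "\<zero> \<notin> \<Union>C" "P \<subseteq> \<Union>C"
      using \<open>C \<noteq> {}\<close> filt(2,3) by blast+
    ultimately show "\<Union>C \<in> A"
      unfolding A_def by (simp add: proper_filter_iff)
  qed
  then obtain M where M: "M \<in> A" "\<forall>X\<in>A. M \<subseteq> X \<longrightarrow> X = M"
    by blast
  have "P \<subseteq> M" "proper_rfilter L M"
    using M(1) unfolding A_def by simp_all
  moreover have "F = M" if "proper_rfilter L F" "M \<subseteq> F" for F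
    using M(2) that \<open>P \<subseteq> M\<close> unfolding A_def by blast
  ultimately have "maximal_rfilter L M"
    unfolding maximal_rfilter_def by blast
  then show ?thesis
    using \<open>P \<subseteq> M\<close> by blast
qed

lemma filter_generated_by_Un:
  assumes F: "rfilter L F" and G: "rfilter L G"
  shows "rfilter L {x \<in> carrier L. \<exists>a\<in>F. \<exists>b\<in>G. a \<otimes> b \<preceq> x}" (is "rfilter L ?H")
proof (rule rfilterI)
  show "?H \<subseteq> carrier L"
    by blast
  show "x \<otimes> y \<in> ?H" if x: "x \<in> ?H" and y: "y \<in> ?H" for x y
  proof -
    obtain a b where ab: "a \<in> F" "b \<in> G" "a \<otimes> b \<preceq> x"
      using x by blast
    obtain c d where cd: "c \<in> F" "d \<in> G" "c \<otimes> d \<preceq> y"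
      using y by blast
    note closed = filter_closed[OF F ab(1)] filter_closed[OF G ab(2)]
      filter_closed[OF F cd(1)] filter_closed[OF G cd(2)]
    have "(a \<otimes> b) \<otimes> (c \<otimes> d) \<preceq> x \<otimes> y"
      using closed ab cd x y mult_mono by simp
    moreover have "(a \<otimes> b) \<otimes> (c \<otimes> d) = (a \<otimes> c) \<otimes> (b \<otimes> d)"
      using closed by (simp add: m_ac)
    ultimately have "(a \<otimes> c) \<otimes> (b \<otimes> d) \<preceq> x \<otimes> y"
      by simp
    moreover have "x \<otimes> y \<in> carrier L"
      using x y by simp
    ultimately show ?thesis
      using filter_mult[OF F ab(1) cd(1)] filter_mult[OF G ab(2) cd(2)] by blast
  qed
  show "y \<in> ?H" if x: "x \<in> ?H" and y: "y \<in> carrier L" "x \<preceq> y" for x y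
  proof -
    obtain a b where ab: "a \<in> F" "b \<in> G" "a \<otimes> b \<preceq> x"
      using x by blast
    have "a \<otimes> b \<preceq> y"
      using ab(3) x y le_trans[of "a \<otimes> b" x y] filter_closed[OF F ab(1)] filter_closed[OF G ab(2)]
      by simp
    then show ?thesis
      using ab y by blast
  qed
  show "\<one> \<in> ?H"
  proof -
    have "\<one> \<otimes> \<one> \<preceq> \<one>"
      by (simp add: le_refl)
    then show ?thesis
      using filter_one[OF F] filter_one[OF G] by blast
  qed
qed

text \<open>
  Two different maximal filters have no proper filter above both of them, so the filter that they
  generate contains \<open>\<zero>\<close>.
\<close>

lemma distinct_maximal_disjoint_elements:
  assumes M: "maximal_rfilter L M" and N: "maximal_rfilter L N" and "M \<noteq> N"
  obtains m n where "m \<in> M" "n \<in> N" "m \<otimes> n = \<zero>"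
proof -
  let ?H = "{x \<in> carrier L. \<exists>a\<in>M. \<exists>b\<in>N. a \<otimes> b \<preceq> x}"
  have filt: "rfilter L M" "rfilter L N"
    using maximal_filterD[OF M] maximal_filterD[OF N] by blast+
  have subM: "M \<subseteq> ?H"
  proof
    fix x assume x: "x \<in> M"
    then have "x \<in> carrier L"
      by (rule filter_closed[OF filt(1)])
    then have "x \<otimes> \<one> \<preceq> x"
      by (simp add: le_refl)
    then show "x \<in> ?H"
      using x \<open>x \<in> carrier L\<close> filter_one[OF filt(2)] by blast
  qed
  have subN: "N \<subseteq> ?H"
  proof
    fix x assume x: "x \<in> N"
    then have "x \<in> carrier L"
      by (rule filter_closed[OF filt(2)])
    then have "\<one> \<otimes> x \<preceq> x"
      by (simp add: le_refl)
    then show "x \<in> ?H"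
      using x \<open>x \<in> carrier L\<close> filter_one[OF filt(1)] by blast
  qed
  have "\<not> proper_rfilter L ?H"
  proof
    assume H: "proper_rfilter L ?H"
    have "M = N"
      by (rule trans[OF maximal_filter_eq[OF M H subM, symmetric] maximal_filter_eq[OF N H subN]])
    then show False
      using \<open>M \<noteq> N\<close> by contradiction
  qed
  then have "\<zero> \<in> ?H"
    using filter_generated_by_Un[OF filt] unfolding proper_filter_iff by blast
  then obtain m n where mn: "m \<in> M" "n \<in> N" "m \<otimes> n \<preceq> \<zero>"
    by blast
  moreover have "m \<in> carrier L" "n \<in> carrier L"
    using filter_closed[OF filt(1) mn(1)] filter_closed[OF filt(2) mn(2)] by simp_all
  ultimately have "m \<otimes> n = \<zero>"
    using le_antisym[of "m \<otimes> n" \<zero>] zero_least[of "m \<otimes> n"] zero_closed by simp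
  then show thesis
    using that[OF mn(1,2)] by blast
qed

section \<open>Lifting a complement modulo an intersection\<close>

text \<open>
  Every representative \<open>x\<close> of the class of \<open>m\<close> shares the two relevant properties of \<open>m\<close>: it
  lies in \<open>M\<close>, and its negation lies in \<open>N\<close>. Dually for the representatives \<open>y\<close> of the class of
  \<open>n\<close>. These properties alone place \<open>x \<curlyvee> y\<close> and the negation of \<open>x \<curlywedge> y\<close> in \<open>M \<inter> N\<close>, so the
  operations of the quotient can be evaluated on all representatives at once.
\<close>

lemma class_complemented_mod_Int:
  assumes M: "rfilter L M" and N: "rfilter L N"
    and m: "m \<in> M" and n: "n \<in> N" and mn: "m \<otimes> n = \<zero>"
  shows "rclass L (M \<inter> N) m \<in> boolean_center (rquot L (M \<inter> N))"
proof -
  let ?F = "M \<inter> N"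
  have F: "rfilter L ?F"
    by (rule filter_Int[OF M N])
  have closed: "m \<in> carrier L" "n \<in> carrier L"
    using filter_closed[OF M m] filter_closed[OF N n] by blast+
  have "n \<preceq> m \<leadsto> \<zero>" "m \<preceq> n \<leadsto> \<zero>"
    using closed mn residuation[of n m \<zero>] residuation[of m n \<zero>] le_refl[OF zero_closed] zero_closed
    by (simp_all add: m_comm)
  then have neg: "m \<leadsto> \<zero> \<in> N" "n \<leadsto> \<zero> \<in> M"
    using filter_up[OF N n] filter_up[OF M m] closed imp_closed zero_closed by simp_all
  have X: "x \<in> M" "x \<leadsto> \<zero> \<in> N" "x \<in> carrier L" if "x \<in> rclass L ?F m" for x
  proof -
    have x: "x \<in> carrier L" "m \<leadsto> x \<in> M" "x \<leadsto> m \<in> N"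
      using that unfolding rclass_def by (auto simp: rcong_iff[OF F])
    then show "x \<in> M" "x \<leadsto> \<zero> \<in> N" "x \<in> carrier L"
      using filter_mp[OF M m] filter_imp_trans[OF N x(3) neg(1)] closed zero_closed by simp_all
  qed
  have Y: "y \<in> N" "y \<leadsto> \<zero> \<in> M" "y \<in> carrier L" if "y \<in> rclass L ?F n" for y
  proof -
    have y: "y \<in> carrier L" "n \<leadsto> y \<in> N" "y \<leadsto> n \<in> M"
      using that unfolding rclass_def by (auto simp: rcong_iff[OF F])
    then show "y \<in> N" "y \<leadsto> \<zero> \<in> M" "y \<in> carrier L"
      using filter_mp[OF N n] filter_imp_trans[OF M y(3) neg(2)] closed zero_closed by simp_all
  qed
  have join: "rclass L ?F (x \<curlyvee> y) = rclass L ?F \<one>"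
    if "x \<in> rclass L ?F m" "y \<in> rclass L ?F n" for x y
  proof (rule rclass_eq_one[OF F])
    show "x \<curlyvee> y \<in> ?F"
      using X[OF that(1)] Y[OF that(2)] filter_up[OF M, of x] filter_up[OF N, of y]
        le_join1 le_join2 join_closed by simp
  qed
  have meet: "rclass L ?F (x \<curlywedge> y) = rclass L ?F \<zero>"
    if "x \<in> rclass L ?F m" "y \<in> rclass L ?F n" for x y
  proof (rule rclass_eq_zero[OF F])
    note x = X[OF that(1)] and y = Y[OF that(2)]
    show xy: "x \<curlywedge> y \<in> carrier L"
      using x y meet_closed by blast
    have "x \<curlywedge> y \<leadsto> x \<in> N" "x \<curlywedge> y \<leadsto> y \<in> M"
      using x y xy imp_eq_one meet_le1 meet_le2 filter_one[OF M] filter_one[OF N] by simp_all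
    then show "x \<curlywedge> y \<leadsto> \<zero> \<in> ?F"
      using x y xy zero_closed filter_imp_trans[OF N _ x(2)] filter_imp_trans[OF M _ y(2)] by simp
  qed
  have self: "m \<in> rclass L ?F m" "n \<in> rclass L ?F n"
    unfolding rclass_def by (rule equiv_class_self[OF equiv_rcong[OF F]], rule closed)+
  have "rlift2 L ?F (rjoin L) (rclass L ?F m) (rclass L ?F n) = rclass L ?F \<one>"
    "rlift2 L ?F (rmeet L) (rclass L ?F m) (rclass L ?F n) = rclass L ?F \<zero>"
    by (rule rlift2_eqI[OF self], rule join meet, assumption+)+
  moreover have "rclass L ?F m \<in> carrier L // rcong L ?F" "rclass L ?F n \<in> carrier L // rcong L ?F"
    unfolding rclass_def by (rule quotientI, rule closed)+
  ultimately show ?thesis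
    unfolding boolean_center_def rquot_def by auto
qed

text \<open>
  A lifted complement \<open>f\<close> of \<open>e\<close> turns \<open>m\<close>, which only separates \<open>M\<close> from \<open>N\<close>, into a splitting
  \<open>e \<curlyvee> f = \<one>\<close> on which the primeness of \<open>P\<close> can act.
\<close>

lemma BLP_maximal_unique:
  assumes "BLP L" and P: "prime_rfilter L P"
    and M: "maximal_rfilter L M" "P \<subseteq> M" and N: "maximal_rfilter L N" "P \<subseteq> N"
  shows "M = N"
proof (rule ccontr)
  assume "M \<noteq> N"
  then obtain m n where mn: "m \<in> M" "n \<in> N" "m \<otimes> n = \<zero>"
    using distinct_maximal_disjoint_elements M(1) N(1) by blast
  have filt: "rfilter L M" "rfilter L N" "rfilter L P" and proper: "\<zero> \<notin> M" "\<zero> \<notin> N"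
    using maximal_filterD[OF M(1)] maximal_filterD[OF N(1)] P
    unfolding prime_rfilter_def proper_filter_iff by simp_all
  note F = filter_Int[OF filt(1,2)]
  have "rclass L (M \<inter> N) m \<in> rclass L (M \<inter> N) ` boolean_center L"
    using class_complemented_mod_Int[OF filt(1,2) mn] \<open>BLP L\<close> F
    unfolding BLP_def filter_BLP_def by blast
  then obtain e where e: "e \<in> boolean_center L" "rclass L (M \<inter> N) m = rclass L (M \<inter> N) e"
    by blast
  then obtain f where f: "e \<in> carrier L" "f \<in> carrier L" "e \<curlyvee> f = \<one>" "e \<curlywedge> f = \<zero>"
    unfolding boolean_center_def by blast
  have "(m, e) \<in> rcong L (M \<inter> N)"
    using e(2) f(1) eq_equiv_class[OF _ equiv_rcong[OF F]] unfolding rclass_def by blast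
  then have imps: "m \<leadsto> e \<in> M" "e \<leadsto> m \<in> N" and m: "m \<in> carrier L"
    by (auto simp: rcong_iff[OF F])
  have "e \<in> M"
    using filter_mp[OF filt(1) mn(1) imps(1) f(1)] .
  moreover have "e \<notin> N"
  proof
    assume "e \<in> N"
    then have "m \<in> N"
      using filter_mp[OF filt(2) _ imps(2) m] by blast
    then show False
      using filter_mult[OF filt(2) _ mn(2)] mn(3) proper(2) by force
  qed
  moreover have "f \<notin> M" if "e \<in> M"
    using that filter_meet_iff[OF filt(1) f(1,2)] f(4) proper(1) by auto
  moreover have "e \<in> P \<or> f \<in> P"
    using P f filter_one[OF filt(3)] unfolding prime_rfilter_def by metis
  ultimately show False
    using M(2) N(2) by blast
qed

end

theorem corollary6p25:
  fixes L :: "('a, 'm) rlat_scheme"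
  assumes "residuated_lattice L"
    and "BLP L"
  shows "Gelfand L"
proof -
  interpret residuated_lattice L
    by fact
  show ?thesis
    unfolding Gelfand_def
  proof (intro allI impI)
    fix P
    assume P: "prime_rfilter L P"
    then have "\<exists>M. maximal_rfilter L M \<and> P \<subseteq> M"
      using proper_filter_subset_maximal unfolding prime_rfilter_def by blast
    then show "\<exists>!M. maximal_rfilter L M \<and> P \<subseteq> M"
      using BLP_maximal_unique[OF \<open>BLP L\<close> P] by blast
  qed
qed

end
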